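(* Let $\mathscr{A}$ be a complex Banach algebra with unit $1$. Let $a,\delta a\in\mathscr{A}$ and put $\bar a=a+\delta a$. Let $p,q,p',q'\in\mathscr{A}$ be idempotents such that $a^{(2,l)}_{p,q}$ exists, and put $\kappa=\|a\|\,\|a^{(2,l)}_{p,q}\|$. If $\|p-p'\|<\dfrac{1}{(\kappa+1)^2}$, $\|q-q'\|<\dfrac{1}{\kappa+3}$ and $\|a^{(2,l)}_{p,q}\|\,\|\delta a\|<\dfrac{2\kappa}{(\kappa+1)(\kappa+4)}$, then $\bar a^{(2,l)}_{p',q'}$ exists and $$\|\bar a^{(2,l)}_{p',q'}\|\le\frac{(1+\|q-q'\|)\|a^{(2,l)}_{p,q}\|}{1-(1+\kappa)\|p-p'\|-\kappa\|q-q'\|-(1+\|q-q'\|)\|a^{(2,l)}_{p,q}\|\|\delta a\|},$$ $$\|\bar a^{(2,l)}_{p',q'}-a^{(2,l)}_{p,q}\|\le\frac{\|a^{(2,l)}_{p,q}\|}{1-(1+\kappa)\|p-p'\|-\kappa\|q-q'\|}\Big[(1+\kappa)(\|p-p'\|+\|q-q'\|)+\frac{(1+\|q-q'\|)^2\|\delta a\|\|a^{(2,l)}_{p,q}\|}{1-(1+\kappa)\|p-p'\|-\kappa\|q-q'\|-(1+\|q-q'\|)\|a^{(2,l)}_{p,q}\|\|\delta a\|}\Big].$$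
   Context: For $x\in\mathscr{A}$ let $R_r(x)=\{xy: y\in\mathscr{A}\}$ and $K_r(x)=\{y\in\mathscr{A}: xy=0\}$. For $a\in\mathscr{A}$ and idempotents $p,q\in\mathscr{A}$, the $(p,q,l)$-outer generalized inverse $a^{(2,l)}_{p,q}$ is an element $b\in\mathscr{A}$ with $bab=b$, $R_r(b)=R_r(p)$, $K_r(b)=R_r(q)$; it is unique if it exists. *)

theory Defs
  imports "HOL-Analysis.Analysis"
begin

text \<open>
  The library has only real Banach algebras, so the complex scalar multiplication is added
  here as an operation extending \<open>scaleR\<close>; the axiom \<open>scaleC 1 x = x\<close> is then inherited from
  \<open>scaleR\<close>. The base is \<open>real_normed_algebra\<close> and \<open>ring_1\<close> rather than
  \<open>real_normed_algebra_1\<close>, so the norm of the unit need not be \<open>1\<close>.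
\<close>

class unital_complex_banach_algebra = real_normed_algebra + ring_1 + banach +
  fixes scaleC :: "complex \<Rightarrow> 'a \<Rightarrow> 'a" (infixr "*\<^sub>C" 75)
  assumes scaleC_of_real: "complex_of_real r *\<^sub>C x = r *\<^sub>R x"
    and scaleC_add_right: "c *\<^sub>C (x + y) = c *\<^sub>C x + c *\<^sub>C y"
    and scaleC_add_left: "(c + d) *\<^sub>C x = c *\<^sub>C x + d *\<^sub>C x"
    and scaleC_scaleC: "c *\<^sub>C (d *\<^sub>C x) = (c * d) *\<^sub>C x"
    and mult_scaleC_left: "(c *\<^sub>C x) * y = c *\<^sub>C (x * y)"
    and mult_scaleC_right: "x * (c *\<^sub>C y) = c *\<^sub>C (x * y)"
    and norm_scaleC: "norm (c *\<^sub>C x) = cmod c * norm x"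

definition R_r :: "'a::ring_1 \<Rightarrow> 'a set"
  where "R_r x = {x * y | y. True}"

definition K_r :: "'a::ring_1 \<Rightarrow> 'a set"
  where "K_r x = {y. x * y = 0}"

definition is_outer_inverse_l :: "'a::ring_1 \<Rightarrow> 'a \<Rightarrow> 'a \<Rightarrow> 'a \<Rightarrow> bool"
  where "is_outer_inverse_l a p q b \<longleftrightarrow> b * a * b = b \<and> R_r b = R_r p \<and> K_r b = R_r q"

definition outer_inverse_l_exists :: "'a::ring_1 \<Rightarrow> 'a \<Rightarrow> 'a \<Rightarrow> bool"
  where "outer_inverse_l_exists a p q \<longleftrightarrow> (\<exists>b. is_outer_inverse_l a p q b)"

text \<open>The element \<open>a\<^sup>(\<^sup>2\<^sup>,\<^sup>l\<^sup>)\<close> for \<open>p, q\<close>; meaningful only under \<open>outer_inverse_l_exists a p q\<close>.\<close>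

definition outer_inverse_l :: "'a::ring_1 \<Rightarrow> 'a \<Rightarrow> 'a \<Rightarrow> 'a"
  where "outer_inverse_l a p q = (THE b. is_outer_inverse_l a p q b)"

lemma is_outer_inverse_l_unique:
  assumes b: "is_outer_inverse_l a p q b" and c: "is_outer_inverse_l a p q c"
  shows "b = c"
proof -
  have bab: "b * a * b = b" and cac: "c * a * c = c"
    and R: "R_r c = R_r b" and K: "K_r b = K_r c"
    using b c by (auto simp: is_outer_inverse_l_def)
  have "c * 1 \<in> R_r b"
    using R unfolding R_r_def by blast
  then obtain y where y: "c = b * y"
    by (auto simp: R_r_def)
  then have "b * a * c = c"
    using bab by (metis mult.assoc)
  moreover have "1 - a * c \<in> K_r b"
    unfolding K using cac by (simp add: K_r_def algebra_simps)
  then have "b = b * a * c"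
    by (simp add: K_r_def algebra_simps)
  ultimately show ?thesis by simp
qed

lemma is_outer_inverse_l_outer_inverse_l:
  assumes "outer_inverse_l_exists a p q"
  shows "is_outer_inverse_l a p q (outer_inverse_l a p q)"
  using assms unfolding outer_inverse_l_exists_def outer_inverse_l_def
  by (metis is_outer_inverse_l_unique theI)

end

theory Submission
  imports Defs
begin

text \<open>
  Write \<open>b\<close> for the given inverse and \<open>b'\<close> for the desired one. Splitting
  \<open>b' = b a b' + (1 - b a) b'\<close> and using \<open>(1 - b a) p = 0\<close>, \<open>b q = 0\<close>, the defining
  properties of \<open>b'\<close> give the linear equation \<open>T b' = b (1 - q')\<close> with
  \<open>T = (1 - b a) (1 - p') + b (1 - q') abar\<close>, equivalently
  \<open>b' = b (1 + q - q') + S b'\<close> with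
  \<open>S = b (q' - q) a - b (1 + q - q') \<delta>a + (1 - b a) (p' - p)\<close>.
  Under the hypotheses \<open>S\<close> is a contraction, so the equation has a unique solution; the solution
  is an outer inverse because \<open>T\<close>, \<open>1 - (p - p')\<close> and \<open>1 - (q - q')\<close> are not left zero
  divisors, and both estimates are read off from the equation.
\<close>

section \<open>Outer inverses described by equations\<close>

lemma mem_R_r_idempotent_iff:
  fixes p :: "'a::ring_1"
  assumes "p * p = p"
  shows "x \<in> R_r p \<longleftrightarrow> p * x = x"
  unfolding R_r_def using assms by (auto simp flip: mult.assoc) metis

text \<open>Replaces the two set equalities by equations that can be used in rewriting. If
  \<open>p = b * z\<close>, then \<open>b * a * p = b * a * b * z = b * z = p\<close>; the kernel of
  \<open>b\<close> is the range of \<open>q\<close>, that is, the set of fixed points of left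
  multiplication by \<open>q\<close>.\<close>

lemma is_outer_inverse_lD:
  fixes a :: "'a::ring_1"
  assumes inv: "is_outer_inverse_l a p q b" and p: "p * p = p" and q: "q * q = q"
  shows "b * a * b = b" "p * b = b" "b * a * p = p" "b * q = 0"
    and "\<And>y. b * y = 0 \<longleftrightarrow> q * y = y"
proof -
  show bab: "b * a * b = b"
    using inv by (simp add: is_outer_inverse_l_def)
  have R: "R_r b = R_r p" and K: "K_r b = R_r q"
    using inv by (auto simp: is_outer_inverse_l_def)
  have "b * 1 \<in> R_r p"
    unfolding R[symmetric] unfolding R_r_def by blast
  then show "p * b = b"
    using p by (simp add: mem_R_r_idempotent_iff)
  have "p * 1 \<in> R_r b"
    unfolding R unfolding R_r_def by blast
  then obtain z where "p = b * z"
    by (auto simp: R_r_def)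
  then show "b * a * p = p"
    using bab by (metis mult.assoc)
  show bker: "b * y = 0 \<longleftrightarrow> q * y = y" for y
    using K q mem_R_r_idempotent_iff[of q y] by (auto simp: K_r_def)
  show "b * q = 0"
    using bker q by blast
qed

text \<open>Converse of \<open>is_outer_inverse_lD\<close>:
  \<open>b * a * b = b * a * p * b = p * b = b\<close>, and the ranges agree because
  \<open>b * y = p * (b * y)\<close> and \<open>p * y = b * (a * p * y)\<close>.\<close>

lemma is_outer_inverse_lI:
  fixes a :: "'a::ring_1"
  assumes p: "p * p = p" and q: "q * q = q"
    and pb: "p * b = b" and bap: "b * a * p = p"
    and ker: "\<And>y. b * y = 0 \<longleftrightarrow> q * y = y"
  shows "is_outer_inverse_l a p q b"
proof -
  have "b * a * b = b"
    using pb bap by (metis mult.assoc)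
  moreover have "R_r b = R_r p"
    unfolding R_r_def using pb bap by (metis (no_types) mult.assoc)
  moreover have "K_r b = R_r q"
    using ker mem_R_r_idempotent_iff[OF q] by (auto simp: K_r_def)
  ultimately show ?thesis
    by (simp add: is_outer_inverse_l_def)
qed

text \<open>The purely algebraic half of existence: the norm hypotheses enter only through the three
  injectivity assumptions. Each required property of \<open>b'\<close> is reduced to the vanishing
  of an element that \<open>T\<close> kills or that \<open>p - p'\<close> or \<open>q - q'\<close>
  fixes.\<close>

lemma is_outer_inverse_l_perturbation:
  fixes a :: "'a::ring_1"
  assumes inv: "is_outer_inverse_l a p q b"
    and idem: "p * p = p" "q * q = q" "p' * p' = p'" "q' * q' = q'"
    and T: "T = (1 - b * a) * (1 - p') + b * (1 - q') * c"
    and b': "T * b' = b * (1 - q')"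
    and T_inj: "\<And>z. T * z = 0 \<Longrightarrow> z = 0"
    and p_inj: "\<And>z. (p - p') * z = z \<Longrightarrow> z = 0"
    and q_inj: "\<And>z. (q - q') * z = z \<Longrightarrow> z = 0"
  shows "is_outer_inverse_l c p' q' b'"
proof (rule is_outer_inverse_lI)
  note b = is_outer_inverse_lD[OF inv idem(1,2)]
  define z where "z = (1 - p') * b'"
  have e0: "(1 - b * a) * b = 0" and ee: "(1 - b * a) * (1 - b * a) = 1 - b * a"
    using b(1) by (simp_all add: left_diff_distrib right_diff_distrib flip: mult.assoc)
  \<comment> \<open>The idempotent \<open>1 - b * a\<close> kills \<open>b\<close>, hence also
    \<open>T * b'\<close>. So \<open>z\<close> lies in the range of \<open>b\<close>, which is that
    of \<open>p\<close>, while \<open>p'\<close> kills it; thus \<open>p - p'\<close> fixes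
    \<open>z\<close>.\<close>
  have "(1 - b * a) * (T * b') = (1 - b * a) * z"
    unfolding T z_def distrib_right distrib_left
    using e0 ee by (simp flip: mult.assoc)
  then have "(1 - b * a) * z = 0"
    using e0 by (simp add: b' flip: mult.assoc)
  then have "z = b * (a * z)"
    by (simp add: algebra_simps)
  then have "p * z = z"
    using b(2) by (metis mult.assoc)
  moreover have "p' * z = 0"
    using idem(3) by (simp add: z_def right_diff_distrib left_diff_distrib flip: mult.assoc)
  ultimately have "z = 0"
    by (intro p_inj) (simp add: left_diff_distrib)
  then show pb': "p' * b' = b'"
    by (simp add: z_def left_diff_distrib)
  \<comment> \<open>Since \<open>(1 - p') * p' = 0\<close>, the right side is
    \<open>T * b' * c * p'\<close>, and \<open>T\<close> can be cancelled.\<close>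
  have "T * p' = b * (1 - q') * c * p'"
    using idem(3) by (simp add: T algebra_simps)
  then have "T * (b' * c * p' - p') = 0"
    using b' by (simp add: right_diff_distrib flip: mult.assoc)
  then show "b' * c * p' = p'"
    using T_inj by fastforce
  show "b' * y = 0 \<longleftrightarrow> q' * y = y" for y
  proof
    assume "b' * y = 0"
    then have "b * ((1 - q') * y) = 0"
      using b' by (metis mult.assoc mult_zero_right)
    then have "q * ((1 - q') * y) = (1 - q') * y"
      using b(5) by blast
    moreover have "q' * ((1 - q') * y) = 0"
      using idem(4) by (simp add: right_diff_distrib left_diff_distrib flip: mult.assoc)
    ultimately have "(1 - q') * y = 0"
      by (intro q_inj) (simp add: left_diff_distrib)
    then show "q' * y = y"
      by (simp add: left_diff_distrib)
  next
    assume y: "q' * y = y"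
    have "T * (b' * y) = b * ((1 - q') * y)"
      using b' by (metis mult.assoc)
    also have "\<dots> = 0"
      using y by (simp add: left_diff_distrib)
    finally show "b' * y = 0"
      using T_inj by blast
  qed
qed (use idem in auto)

section \<open>Contractions and the size of the perturbation\<close>

text \<open>The Neumann series is avoided because the norm of the unit need not be 1.\<close>

lemma contraction_unique_solution:
  fixes S c :: "'a::{real_normed_algebra,banach}"
  assumes S: "\<And>x. norm (S * x) \<le> s * norm x" and s: "s < 1"
  shows "\<exists>!x. x = c + S * x"
proof -
  have "\<exists>!x. c + S * x = x"
  proof (rule banach_fix_type)
    \<comment> \<open>\<open>banach_fix_type\<close> asks for a nonnegative factor, and
      \<open>s\<close> has no sign assumption.\<close>
    show "\<forall>x y. dist (c + S * x) (c + S * y) \<le> max 0 s * dist x y"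
    proof (intro allI)
      fix x y
      have "dist (c + S * x) (c + S * y) = norm (S * (x - y))"
        by (simp add: dist_norm right_diff_distrib)
      also have "\<dots> \<le> s * norm (x - y)"
        by (rule S)
      also have "\<dots> \<le> max 0 s * norm (x - y)"
        by (intro mult_right_mono) auto
      finally show "dist (c + S * x) (c + S * y) \<le> max 0 s * dist x y"
        by (simp add: dist_norm)
    qed
  qed (use s in auto)
  then show ?thesis
    by metis
qed

lemma norm_mult_le_of_norm_le:
  fixes x y :: "'a::real_normed_algebra"
  assumes "norm x \<le> c"
  shows "norm (x * y) \<le> c * norm y"
  by (rule order_trans[OF norm_mult_ineq mult_right_mono[OF assms norm_ge_zero]])

lemma mult_eq_self_norm_less_1:
  fixes x z :: "'a::real_normed_algebra"
  assumes "x * z = z" "norm x < 1"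
  shows "z = 0"
proof (rule ccontr)
  assume "z \<noteq> 0"
  have "norm z \<le> norm x * norm z"
    using assms(1) norm_mult_ineq[of x z] by simp
  also have "\<dots> < 1 * norm z"
    using assms(2) \<open>z \<noteq> 0\<close> by (intro mult_strict_right_mono) auto
  finally show False by simp
qed

text \<open>The three bounds are tuned to add up to exactly 1: they contribute 1/(\<kappa>+1),
  \<kappa>/(\<kappa>+3) and 2\<kappa>/((\<kappa>+1)(\<kappa>+3)). The factor \<kappa>+4 cancels
  against 1 + 1/(\<kappa>+3) = (\<kappa>+4)/(\<kappa>+3).\<close>

lemma perturbation_size_less_1:
  fixes \<kappa> \<epsilon> \<eta> t :: real
  assumes \<kappa>: "0 < \<kappa>" and \<eta>0: "0 \<le> \<eta>"
    and \<epsilon>: "\<epsilon> < 1 / (\<kappa> + 1)^2" and \<eta>: "\<eta> < 1 / (\<kappa> + 3)"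
    and t: "t < 2 * \<kappa> / ((\<kappa> + 1) * (\<kappa> + 4))"
  shows "(1 + \<kappa>) * \<epsilon> + \<kappa> * \<eta> + (1 + \<eta>) * t < 1"
proof -
  have "(1 + \<kappa>) * \<epsilon> < (1 + \<kappa>) * (1 / (\<kappa> + 1)^2)"
    using \<kappa> \<epsilon> by (intro mult_strict_left_mono) auto
  also have "\<dots> = 1 / (\<kappa> + 1)"
    using \<kappa> by (simp add: power2_eq_square add.commute)
  finally have 1: "(1 + \<kappa>) * \<epsilon> < 1 / (\<kappa> + 1)" .
  have 2: "\<kappa> * \<eta> < \<kappa> * (1 / (\<kappa> + 3))"
    using \<kappa> \<eta> by (intro mult_strict_left_mono) auto
  have "(1 + \<eta>) * t \<le> (1 + \<eta>) * (2 * \<kappa> / ((\<kappa> + 1) * (\<kappa> + 4)))"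
    using \<eta>0 t by (intro mult_left_mono) auto
  also have "\<dots> \<le> (1 + 1 / (\<kappa> + 3)) * (2 * \<kappa> / ((\<kappa> + 1) * (\<kappa> + 4)))"
    using \<kappa> \<eta> by (intro mult_right_mono) auto
  also have "1 + 1 / (\<kappa> + 3) = (\<kappa> + 4) / (\<kappa> + 3)"
    using \<kappa> by (simp add: field_simps)
  also have "(\<kappa> + 4) / (\<kappa> + 3) * (2 * \<kappa> / ((\<kappa> + 1) * (\<kappa> + 4))) = 2 * \<kappa> / ((\<kappa> + 1) * (\<kappa> + 3))"
    using \<kappa> by simp
  finally have 3: "(1 + \<eta>) * t \<le> 2 * \<kappa> / ((\<kappa> + 1) * (\<kappa> + 3))" .
  have "1 / (\<kappa> + 1) + \<kappa> * (1 / (\<kappa> + 3)) + 2 * \<kappa> / ((\<kappa> + 1) * (\<kappa> + 3)) = 1"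
    using \<kappa> by (simp add: divide_simps) (simp add: algebra_simps)
  then show ?thesis
    using 1 2 3 by linarith
qed

section \<open>Solving the perturbed equation and estimating its solution\<close>

theorem theorem4p8:
  fixes a \<delta>a abar p q p' q' :: "'a :: unital_complex_banach_algebra"
    and \<kappa> :: real
  assumes abar: "abar = a + \<delta>a"
    and idempotents: "p * p = p" "q * q = q" "p' * p' = p'" "q' * q' = q'"
    and ex: "outer_inverse_l_exists a p q"
    and kappa: "\<kappa> = norm a * norm (outer_inverse_l a p q)"
    and p_close: "norm (p - p') < 1 / (\<kappa> + 1)^2"
    and q_close: "norm (q - q') < 1 / (\<kappa> + 3)"
    and a_close: "norm (outer_inverse_l a p q) * norm \<delta>a < 2 * \<kappa> / ((\<kappa> + 1) * (\<kappa> + 4))"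
  shows "outer_inverse_l_exists abar p' q' \<and>
    norm (outer_inverse_l abar p' q')
      \<le> (1 + norm (q - q')) * norm (outer_inverse_l a p q)
        / (1 - (1 + \<kappa>) * norm (p - p') - \<kappa> * norm (q - q')
             - (1 + norm (q - q')) * norm (outer_inverse_l a p q) * norm \<delta>a) \<and>
    norm (outer_inverse_l abar p' q' - outer_inverse_l a p q)
      \<le> norm (outer_inverse_l a p q)
        / (1 - (1 + \<kappa>) * norm (p - p') - \<kappa> * norm (q - q'))
        * ((1 + \<kappa>) * (norm (p - p') + norm (q - q'))
           + (1 + norm (q - q'))^2 * norm \<delta>a * norm (outer_inverse_l a p q)
             / (1 - (1 + \<kappa>) * norm (p - p') - \<kappa> * norm (q - q')
                  - (1 + norm (q - q')) * norm (outer_inverse_l a p q) * norm \<delta>a))"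
proof -
  define b where "b = outer_inverse_l a p q"
  define \<beta> where "\<beta> = norm b"
  define \<epsilon> where "\<epsilon> = norm (p - p')"
  define \<eta> where "\<eta> = norm (q - q')"
  define \<delta> where "\<delta> = norm \<delta>a"
  have inv: "is_outer_inverse_l a p q b"
    unfolding b_def using ex by (rule is_outer_inverse_l_outer_inverse_l)
  note b = is_outer_inverse_lD[OF inv idempotents(1,2)]
  have nonneg: "0 \<le> \<beta>" "0 \<le> \<epsilon>" "0 \<le> \<eta>" "0 \<le> \<delta>" "0 \<le> \<kappa>"
    by (auto simp: \<beta>_def \<epsilon>_def \<eta>_def \<delta>_def kappa)
  have "\<kappa> \<noteq> 0"
  proof
    assume "\<kappa> = 0"
    with a_close have "norm (outer_inverse_l a p q) * norm \<delta>a < 0" by simp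
    then show False
      by (simp add: mult_less_0_iff)
  qed
  with nonneg have \<kappa>0: "0 < \<kappa>" by simp
  have \<kappa>\<beta>: "\<kappa> = norm a * \<beta>"
    by (simp add: kappa b_def \<beta>_def)
  have \<epsilon>1: "\<epsilon> < 1"
    using p_close \<kappa>0 less_le_trans[of \<epsilon> "1 / (\<kappa> + 1)^2" 1] by (simp add: \<epsilon>_def)
  have \<eta>1: "\<eta> < 1"
    using q_close \<kappa>0 less_le_trans[of \<eta> "1 / (\<kappa> + 3)" 1] by (simp add: \<eta>_def)

  \<comment> \<open>Factors such as \<open>1 + q - q'\<close> and \<open>1 - b * a\<close> are
    multiplied out: the norm of the unit may exceed 1, which would spoil the constants 1+\<eta> and
    1+\<kappa>.\<close>
  define S where "S = b * (q' - q) * a - (b + b * (q - q')) * \<delta>a + (p' - p - b * a * (p' - p))"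
  define T where "T = (1 - b * a) * (1 - p') + b * (1 - q') * abar"
  have ST: "S = 1 - T"
    using b(3,4) by (simp add: S_def T_def abar algebra_simps)
  \<comment> \<open>\<open>D\<close> and \<open>D - t\<close> are the two denominators of the claim.
    \<open>t\<close> bounds the part of \<open>S\<close> that contains \<delta>a, and 1 -
    (\<open>D - t\<close>) is the contraction constant of \<open>S\<close>.\<close>
  define D where "D = 1 - (1 + \<kappa>) * \<epsilon> - \<kappa> * \<eta>"
  define t where "t = (1 + \<eta>) * \<beta> * \<delta>"
  have "(1 + \<kappa>) * \<epsilon> + \<kappa> * \<eta> + (1 + \<eta>) * (\<beta> * \<delta>) < 1"
    using perturbation_size_less_1[OF \<kappa>0 nonneg(3)] p_close q_close a_close
    by (simp add: \<epsilon>_def \<eta>_def \<beta>_def \<delta>_def b_def)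
  then have Dt: "0 < D - t"
    by (simp add: D_def t_def mult.assoc)
  have "0 \<le> t"
    using nonneg by (simp add: t_def)
  with Dt have D: "0 < D" by simp

  have bq: "norm (b * (q - q')) \<le> \<beta> * \<eta>"
    unfolding \<beta>_def \<eta>_def by (rule norm_mult_ineq)
  have ba: "norm (b * a) \<le> \<kappa>"
    using norm_mult_ineq[of b a] by (simp add: \<kappa>\<beta> \<beta>_def mult.commute)
  have S1: "norm (b * (q' - q) * a * x) \<le> \<kappa> * \<eta> * norm x" for x
  proof -
    have "norm (b * (q' - q) * a * x) \<le> norm b * norm (q' - q) * norm a * norm x"
      by (intro norm_mult_le_of_norm_le norm_mult_ineq)
    then show ?thesis
      by (simp add: \<kappa>\<beta> \<beta>_def \<eta>_def norm_minus_commute mult_ac)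
  qed
  have S2: "norm ((b + b * (q - q')) * \<delta>a * x) \<le> t * norm x" for x
  proof -
    have "norm (b + b * (q - q')) \<le> (1 + \<eta>) * \<beta>"
      using norm_triangle_ineq[of b "b * (q - q')"] bq by (simp add: \<beta>_def algebra_simps)
    then have "norm (b + b * (q - q')) * \<delta> * norm x \<le> t * norm x"
      unfolding t_def using nonneg by (intro mult_right_mono) auto
    moreover have "norm ((b + b * (q - q')) * \<delta>a * x) \<le> norm (b + b * (q - q')) * \<delta> * norm x"
      unfolding \<delta>_def by (intro norm_mult_le_of_norm_le norm_mult_ineq)
    ultimately show ?thesis by linarith
  qed
  have S3: "norm ((p' - p - b * a * (p' - p)) * x) \<le> (1 + \<kappa>) * \<epsilon> * norm x" for x
  proof -
    have "norm (b * a * (p' - p)) \<le> \<kappa> * \<epsilon>"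
      using norm_mult_ineq[of "b * a" "p' - p"] mult_right_mono[OF ba nonneg(2)]
      by (simp add: \<epsilon>_def norm_minus_commute)
    then have "norm (p' - p - b * a * (p' - p)) \<le> (1 + \<kappa>) * \<epsilon>"
      using norm_triangle_ineq4[of "p' - p" "b * a * (p' - p)"]
      by (simp add: \<epsilon>_def norm_minus_commute algebra_simps)
    then show ?thesis
      by (rule norm_mult_le_of_norm_le)
  qed
  have S: "norm (S * x) \<le> (1 - (D - t)) * norm x" for x
  proof -
    have "S * x = b * (q' - q) * a * x - (b + b * (q - q')) * \<delta>a * x
        + (p' - p - b * a * (p' - p)) * x"
      by (simp only: S_def distrib_right left_diff_distrib)
    moreover have "norm (u - v + w) \<le> norm u + norm v + norm w" for u v w :: 'a
      using norm_triangle_ineq[of "u - v" w] norm_triangle_ineq4[of u v] by linarith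
    ultimately have "norm (S * x) \<le> norm (b * (q' - q) * a * x)
        + norm ((b + b * (q - q')) * \<delta>a * x) + norm ((p' - p - b * a * (p' - p)) * x)"
      by metis
    with S1[of x] S2[of x] S3[of x] show ?thesis
      by (simp add: D_def algebra_simps)
  qed
  have sol: "\<exists>!x. x = c + S * x" for c
    using contraction_unique_solution[of S _ c, OF S] Dt by simp

  obtain b' where b': "b' = (b + b * (q - q')) + S * b'"
    using sol by blast
  have Tb': "T * b' = b * (1 - q')"
  proof -
    have "T * b' = b' - S * b'"
      by (simp add: ST left_diff_distrib)
    also have "\<dots> = b + b * (q - q')"
      using b' by (metis add_diff_cancel_right')
    finally show ?thesis
      using b(4) by (simp add: algebra_simps)
  qed
  have inv': "is_outer_inverse_l abar p' q' b'"
  proof (rule is_outer_inverse_l_perturbation[OF inv idempotents T_def Tb'])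
    show "z = 0" if "T * z = 0" for z
    proof -
      \<comment> \<open>As \<open>T = 1 - S\<close>, the kernel of \<open>T\<close> consists of the
        solutions of the homogeneous equation, of which 0 is the only one.\<close>
      have "z = 0 + S * z"
        using that by (simp add: ST left_diff_distrib)
      moreover have "(0::'a) = 0 + S * 0" by simp
      ultimately show "z = 0"
        using sol[of 0] by blast
    qed
    show "z = 0" if "(p - p') * z = z" for z
      using that \<epsilon>1 by (auto simp: \<epsilon>_def intro: mult_eq_self_norm_less_1)
    show "z = 0" if "(q - q') * z = z" for z
      using that \<eta>1 by (auto simp: \<eta>_def intro: mult_eq_self_norm_less_1)
  qed
  then have ex': "outer_inverse_l_exists abar p' q'"
    by (auto simp: outer_inverse_l_exists_def)
  have b'_eq: "outer_inverse_l abar p' q' = b'"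
    using is_outer_inverse_l_unique is_outer_inverse_l_outer_inverse_l[OF ex'] inv' by blast

  have "norm b' \<le> norm (b + b * (q - q')) + norm (S * b')"
    by (metis b' norm_triangle_ineq)
  also have "\<dots> \<le> (\<beta> + \<beta> * \<eta>) + (1 - (D - t)) * norm b'"
    using norm_triangle_ineq[of b "b * (q - q')"] bq S[of b'] by (simp add: \<beta>_def)
  finally have "norm b' * (D - t) \<le> (1 + \<eta>) * \<beta>"
    by (simp add: algebra_simps)
  then have bound1: "norm b' \<le> (1 + \<eta>) * \<beta> / (D - t)"
    using Dt by (simp add: pos_le_divide_eq)

  have triangle: "norm (u + (v - w + x + y + z))
      \<le> norm u + norm v + norm w + norm x + norm y + norm z" for u v w x y z :: 'a
    using norm_triangle_ineq[of u "v - w + x + y + z"] norm_triangle_ineq[of "v - w + x + y" z]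
      norm_triangle_ineq[of "v - w + x" y] norm_triangle_ineq[of "v - w" x]
      norm_triangle_ineq4[of v w]
    by linarith
  define d where "d = b' - b"
  have "d = b * (q - q') + S * b'"
    using b' by (simp add: d_def algebra_simps)
  \<comment> \<open>Only the terms free of \<delta>a are split by \<open>b' = b + d\<close>. Their
    \<open>d\<close> parts are absorbed on the left and produce the factor \<open>D\<close>; the
    \<delta>a term keeps \<open>b'\<close> and is controlled by \<open>bound1\<close>, whence the
    inner fraction over \<open>D - t\<close>.\<close>
  also have "S * b' = b * (q' - q) * a * b - (b + b * (q - q')) * \<delta>a * b'
      + (p' - p - b * a * (p' - p)) * b
      + b * (q' - q) * a * d + (p' - p - b * a * (p' - p)) * d"
    by (simp add: S_def d_def algebra_simps)
  finally have "norm d \<le> norm (b * (q - q')) + norm (b * (q' - q) * a * b)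
      + norm ((b + b * (q - q')) * \<delta>a * b') + norm ((p' - p - b * a * (p' - p)) * b)
      + norm (b * (q' - q) * a * d) + norm ((p' - p - b * a * (p' - p)) * d)"
    by (metis triangle)
  also have "\<dots> \<le> \<beta> * \<eta> + \<kappa> * \<eta> * \<beta> + t * norm b' + (1 + \<kappa>) * \<epsilon> * \<beta>
      + \<kappa> * \<eta> * norm d + (1 + \<kappa>) * \<epsilon> * norm d"
    unfolding \<beta>_def by (intro add_mono S1 S2 S3 bq[unfolded \<beta>_def])
  finally have "norm d * D \<le> \<beta> * ((1 + \<kappa>) * (\<epsilon> + \<eta>)) + t * norm b'"
    by (simp add: D_def algebra_simps)
  also have "\<dots> \<le> \<beta> * ((1 + \<kappa>) * (\<epsilon> + \<eta>)) + t * ((1 + \<eta>) * \<beta> / (D - t))"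
    using bound1 \<open>0 \<le> t\<close> by (intro add_left_mono mult_left_mono)
  also have "\<dots> = \<beta> * ((1 + \<kappa>) * (\<epsilon> + \<eta>) + (1 + \<eta>)^2 * \<delta> * \<beta> / (D - t))"
    by (simp add: t_def power2_eq_square algebra_simps)
  finally have bound2:
    "norm d \<le> \<beta> / D * ((1 + \<kappa>) * (\<epsilon> + \<eta>) + (1 + \<eta>)^2 * \<delta> * \<beta> / (D - t))"
    using D by (simp add: pos_le_divide_eq)

  show ?thesis
    using ex' bound1 bound2
    unfolding b'_eq d_def D_def t_def \<epsilon>_def \<eta>_def \<beta>_def \<delta>_def b_def by blast
qed

end
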